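(* Let $\mathcal{I}=[a,b]$ with $0\le a<b$, and let $F:\mathcal{I}\rightrightarrows\mathbb{R}$ be a set-valued map such that $F(x)$ is convex for every $x\in\mathcal{I}$. Then for every $\nu>0$ and $\rho\ne -1$ the Katugampola fractional integral of $F$ preserves convexity; that is, ${}_a^{\rho}\mathfrak{D}^{\nu}F(t)$ is convex for all $t\in\mathcal{I}$.
   Context: A set-valued map $F:\mathcal{I}\rightrightarrows\mathbb{R}$ assigns to each $t\in\mathcal{I}$ a subset $F(t)\subset\mathbb{R}$. An (integrable) selection of $F$ is a single-valued measurable function $f:\mathcal{I}\to\mathbb{R}$ with $f(t)\in F(t)$ for a.e. $t$ and $f\in L^1(\mathcal{I})$; $\mathfrak{I}$ denotes the collection of all integrable selections of $F$. The set-valued Katugampola fractional integral of $F$ (for real $\nu>0$, $\rho\ne-1$) is $${}_a^{\rho}\mathfrak{D}^{\nu}F(t)=\left\{\frac{(\rho+1)^{1-\nu}}{\Gamma(\nu)}\int_a^t (t^{\rho+1}-x^{\rho+1})^{\nu-1}x^{\rho}f(x)\,dx : f\in\mathfrak{I}\right\},\quad t\in\mathcal{I}.$$ The empty set counts as convex. *)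

theory Defs
  imports "HOL-Analysis.Analysis"
begin

definition integrable_selections :: "real set \<Rightarrow> (real \<Rightarrow> real set) \<Rightarrow> (real \<Rightarrow> real) set" where
  "integrable_selections I F =
     {f. f absolutely_integrable_on I \<and> (AE t in lebesgue_on I. f t \<in> F t)}"

definition katugampola_integrand :: "real \<Rightarrow> real \<Rightarrow> (real \<Rightarrow> real) \<Rightarrow> real \<Rightarrow> real \<Rightarrow> real" where
  "katugampola_integrand \<rho> \<nu> f t x =
     (t powr (\<rho> + 1) - x powr (\<rho> + 1)) powr (\<nu> - 1) * x powr \<rho> * f x"

definition katugampola_integral :: "real \<Rightarrow> real \<Rightarrow> real \<Rightarrow> (real \<Rightarrow> real) \<Rightarrow> real \<Rightarrow> real" where
  "katugampola_integral a \<rho> \<nu> f t =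
     (\<rho> + 1) powr (1 - \<nu>) / Gamma \<nu> *
       (LINT x:{a..t}|lebesgue. katugampola_integrand \<rho> \<nu> f t x)"

text \<open>
  For \<open>\<rho> < -1\<close> the prefactor and the kernel are real powers of negative numbers. Since
  \<^const>\<open>ln\<close> on the reals is even, \<^const>\<open>powr\<close> there means the power of the absolute value.
  The phases of the two principal complex powers are inverse to each other, so the real formula
  gives the same product as the complex one:
\<close>

lemma katugampola_kernel_principal_value:
  fixes \<rho> \<nu> t x :: real
  assumes "\<rho> \<noteq> -1" "0 < x" "x < t"
  shows "of_real (\<rho> + 1) powr of_real (1 - \<nu>) *
           of_real (t powr (\<rho> + 1) - x powr (\<rho> + 1)) powr of_real (\<nu> - 1) =
         (of_real ((\<rho> + 1) powr (1 - \<nu>) *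
           (t powr (\<rho> + 1) - x powr (\<rho> + 1)) powr (\<nu> - 1)) :: complex)"
proof -
  define A where "A = \<rho> + 1"
  define B where "B = t powr (\<rho> + 1) - x powr (\<rho> + 1)"
  consider "A > 0" "B > 0" | "A < 0" "B < 0"
  proof (cases "A > 0")
    case True
    then have "B > 0"
      using assms by (simp add: A_def B_def powr_less_mono2)
    then show ?thesis using True that by blast
  next
    case False
    then have "A < 0" using assms by (simp add: A_def)
    then have "B < 0"
      using assms powr_less_mono2_neg[of A x t] by (simp add: A_def B_def)
    then show ?thesis using \<open>A < 0\<close> that by blast
  qed
  then have "of_real A powr of_real (1 - \<nu>) * of_real B powr of_real (\<nu> - 1) =
      (of_real (A powr (1 - \<nu>) * B powr (\<nu> - 1)) :: complex)"
  proof cases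
    case 1
    then show ?thesis by (simp only: powr_of_real of_real_mult less_imp_le)
  next
    case 2
    have L: "Ln (of_real r) = of_real (ln r) + \<i> * of_real pi" if "r < 0" for r :: real
    proof -
      have "Ln (- of_real (- r)) = Ln (of_real (- r)) + \<i> * of_real pi"
        using that by (subst Ln_minus) auto
      also have "Ln (of_real (- r)) = of_real (ln (- r))"
        using that by (intro Ln_of_real) simp
      finally show ?thesis by (simp add: ln_minus)
    qed
    have "of_real A powr of_real (1 - \<nu>) * of_real B powr of_real (\<nu> - 1) =
        exp (of_real ((1 - \<nu>) * ln A + (\<nu> - 1) * ln B) :: complex)"
      using 2 by (simp add: powr_def L flip: exp_add) (simp add: algebra_simps)
    also have "\<dots> = of_real (exp ((1 - \<nu>) * ln A + (\<nu> - 1) * ln B))"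
      by (rule exp_of_real)
    also have "exp ((1 - \<nu>) * ln A + (\<nu> - 1) * ln B) = A powr (1 - \<nu>) * B powr (\<nu> - 1)"
      using 2 by (simp add: powr_def exp_add)
    finally show ?thesis .
  qed
  then show ?thesis by (simp only: A_def B_def)
qed

text \<open>
  An \<open>L\<^sup>1\<close> selection need not have a convergent integral at every \<open>t\<close> (for \<open>\<nu> < 1\<close> the kernel
  is singular at \<open>x = t\<close>), and a divergent Lebesgue integral is \<open>0\<close> by convention in the library.
  The integrability condition keeps this spurious value out: a selection contributes
  to the set at \<open>t\<close> exactly when its integral at \<open>t\<close> exists.
\<close>

definition set_katugampola_integral ::
    "real \<Rightarrow> real \<Rightarrow> real \<Rightarrow> real \<Rightarrow> (real \<Rightarrow> real set) \<Rightarrow> real \<Rightarrow> real set" where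
  "set_katugampola_integral a b \<rho> \<nu> F t =
     {katugampola_integral a \<rho> \<nu> f t | f.
        f \<in> integrable_selections {a..b} F \<and>
        set_integrable lebesgue {a..t} (katugampola_integrand \<rho> \<nu> f t)}"

end

theory Submission
  imports Defs
begin

lemma convex_integrable_selections:
  assumes F: "\<And>x. x \<in> I \<Longrightarrow> convex (F x)"
    and f: "f \<in> integrable_selections I F" and g: "g \<in> integrable_selections I F"
    and uv: "0 \<le> u" "0 \<le> v" "u + v = 1"
  shows "(\<lambda>x. u * f x + v * g x) \<in> integrable_selections I F"
proof -
  have "(\<lambda>x. u * f x + v * g x) absolutely_integrable_on I"
    using f g by (auto simp: integrable_selections_def)
  moreover have "AE x in lebesgue_on I. u * f x + v * g x \<in> F x"
  proof -
    have "AE x in lebesgue_on I. f x \<in> F x" "AE x in lebesgue_on I. g x \<in> F x"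
      using f g by (auto simp: integrable_selections_def)
    \<comment> \<open>Convexity of \<open>F x\<close> is known only for \<open>x\<close> in
      \<open>I\<close>, so membership has to accompany the two almost-everywhere facts.\<close>
    moreover have "AE x in lebesgue_on I. x \<in> I"
      by (rule AE_I2) (simp add: space_restrict_space)
    ultimately show ?thesis
    proof eventually_elim
      case (elim x)
      then show ?case
        using convexD[OF F, of x "f x" "g x" u v] uv by simp
    qed
  qed
  ultimately show ?thesis
    by (simp add: integrable_selections_def)
qed

lemma katugampola_integrand_linear:
  "katugampola_integrand \<rho> \<nu> (\<lambda>x. u * f x + v * g x) t =
     (\<lambda>x. u * katugampola_integrand \<rho> \<nu> f t x + v * katugampola_integrand \<rho> \<nu> g t x)"
  by (simp add: katugampola_integrand_def fun_eq_iff algebra_simps)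

text \<open>Both integrability hypotheses matter: a divergent integral has the default value 0, for
  which additivity can fail.\<close>

lemma katugampola_integral_linear:
  assumes "set_integrable lebesgue {a..t} (katugampola_integrand \<rho> \<nu> f t)"
    and "set_integrable lebesgue {a..t} (katugampola_integrand \<rho> \<nu> g t)"
  shows "katugampola_integral a \<rho> \<nu> (\<lambda>x. u * f x + v * g x) t =
    u * katugampola_integral a \<rho> \<nu> f t + v * katugampola_integral a \<rho> \<nu> g t"
  using assms
  by (simp add: katugampola_integral_def katugampola_integrand_linear ring_distribs mult.left_commute)

theorem theorem3p2:
  fixes a b \<rho> \<nu> :: real and F :: "real \<Rightarrow> real set"
  assumes "0 \<le> a" and "a < b"
    and "\<And>x. x \<in> {a..b} \<Longrightarrow> convex (F x)"
    and "\<nu> > 0" and "\<rho> \<noteq> -1"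
  shows "\<forall>t\<in>{a..b}. convex (set_katugampola_integral a b \<rho> \<nu> F t)"
proof (intro ballI convexI)
  fix t y z u v :: real
  assume y: "y \<in> set_katugampola_integral a b \<rho> \<nu> F t"
    and z: "z \<in> set_katugampola_integral a b \<rho> \<nu> F t"
    and uv: "0 \<le> u" "0 \<le> v" "u + v = 1"
  obtain f where f: "f \<in> integrable_selections {a..b} F"
      "set_integrable lebesgue {a..t} (katugampola_integrand \<rho> \<nu> f t)"
      "y = katugampola_integral a \<rho> \<nu> f t"
    using y by (auto simp: set_katugampola_integral_def)
  obtain g where g: "g \<in> integrable_selections {a..b} F"
      "set_integrable lebesgue {a..t} (katugampola_integrand \<rho> \<nu> g t)"
      "z = katugampola_integral a \<rho> \<nu> g t"
    using z by (auto simp: set_katugampola_integral_def)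
  \<comment> \<open>By linearity, the selection producing \<open>u * y + v * z\<close> is the
    combination of \<open>f\<close> and \<open>g\<close> with the same weights.\<close>
  let ?h = "\<lambda>x. u * f x + v * g x"
  have "?h \<in> integrable_selections {a..b} F"
    using assms(3) f(1) g(1) uv by (intro convex_integrable_selections) auto
  moreover have "set_integrable lebesgue {a..t} (katugampola_integrand \<rho> \<nu> ?h t)"
    using f(2) g(2) by (simp add: katugampola_integrand_linear)
  moreover have "u *\<^sub>R y + v *\<^sub>R z = katugampola_integral a \<rho> \<nu> ?h t"
    using f g by (simp add: katugampola_integral_linear)
  ultimately show "u *\<^sub>R y + v *\<^sub>R z \<in> set_katugampola_integral a b \<rho> \<nu> F t"
    unfolding set_katugampola_integral_def by blast
qed

end
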